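(* Let $(W,S)$ be a Coxeter system with $S=D$ finite and $W$ infinite. Suppose $W(t)=R(t)/S(t)$ where $R(t)=\prod_{i=1}^m[n_i]$ for some integers $n_i\ge 2$ and $S(t)$ is a polynomial; put $N=\sum_{i=1}^m(n_i-1)$ and let $b_j$ be the coefficient of $t^j$ in $S(t)$. Then $$b_{N-1}-m\,b_N=\sum_{X\subsetneq D,\ |W_X|=\infty}(-1)^{|X|}|X|+(-1)^{|D|}|D|.$$
   Context: $[n]=1+t+\dots+t^{n-1}$. For $X\subseteq S$, $W_X$ is the special subgroup generated by $X$; $W(t)=\sum_{g\in W}t^{l(g)}$ is the Poincaré series with respect to word length in $S$ (a rational function). *)

theory Defs
  imports "HOL-Algebra.Generated_Groups" "HOL-Computational_Algebra.Polynomial"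
          "HOL-Computational_Algebra.Polynomial_FPS"
begin

definition coxeter_system :: "'w monoid \<Rightarrow> 'w set \<Rightarrow> bool" where
  "coxeter_system W S \<longleftrightarrow>
     group W \<and> S \<subseteq> carrier W \<and> \<one>\<^bsub>W\<^esub> \<notin> S \<and>
     (\<forall>s\<in>S. s \<otimes>\<^bsub>W\<^esub> s = \<one>\<^bsub>W\<^esub>) \<and>
     generate W S = carrier W \<and>
     (\<forall>(H :: nat monoid) f. group H \<and> f \<in> S \<rightarrow> carrier H \<and>
        (\<forall>s\<in>S. \<forall>t\<in>S. \<forall>k::nat.
            (s \<otimes>\<^bsub>W\<^esub> t) [^]\<^bsub>W\<^esub> k = \<one>\<^bsub>W\<^esub> \<longrightarrow>
            (f s \<otimes>\<^bsub>H\<^esub> f t) [^]\<^bsub>H\<^esub> k = \<one>\<^bsub>H\<^esub>)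
      \<longrightarrow> (\<exists>h \<in> hom W H. \<forall>s\<in>S. h s = f s))"

definition coxeter_length :: "'w monoid \<Rightarrow> 'w set \<Rightarrow> 'w \<Rightarrow> nat" where
  "coxeter_length W S g =
     (LEAST n. \<exists>ws. length ws = n \<and> set ws \<subseteq> S \<and>
                   foldr (\<lambda>x y. x \<otimes>\<^bsub>W\<^esub> y) ws \<one>\<^bsub>W\<^esub> = g)"

definition poincare_series :: "'w monoid \<Rightarrow> 'w set \<Rightarrow> real fps" where
  "poincare_series W S =
     Abs_fps (\<lambda>n. real (card {g \<in> carrier W. coxeter_length W S g = n}))"

definition qint :: "nat \<Rightarrow> real poly" where
  "qint n = (\<Sum>k<n. monom 1 k)"

end

theory Submission
  imports Defs "HOL-Algebra.Weak_Morphisms" "HOL-Library.Countable_Set"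
begin

text \<open>Let \<open>A\<^sub>Y(t)\<close> enumerate by length the elements of \<open>W\<close> whose right descent set contains \<open>Y\<close>. By
  inclusion-exclusion \<open>\<Sum> (-1)\<^bsup>|Y|\<^esup> A\<^sub>Y(t) = 1\<close>, as only the identity has no descents. If \<open>A\<^sub>Y \<noteq> 0\<close> then
  \<open>W\<^sub>Y\<close> is finite, and factoring through its longest element, of length \<open>l\<^sub>Y\<close>, gives
  \<open>A\<^sub>Y(t) = t\<^bsup>l\<^sub>Y\<^esup> W(t) / W\<^sub>Y(t)\<close>. Hence \<open>1/W(t) = \<Sum> (-1)\<^bsup>|Y|\<^esup> t\<^bsup>l\<^sub>Y\<^esup> / W\<^sub>Y(t)\<close> over the \<open>Y\<close> with
  \<open>W\<^sub>Y\<close> finite. Since \<open>W\<^sub>Y(t)\<close> begins with \<open>t\<^bsup>l\<^sub>Y\<^esup> + |Y| t\<^bsup>l\<^sub>Y - 1\<^esup>\<close>, comparing the two highest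
  coefficients gives \<open>b\<^sub>N\<^sub>-\<^sub>1 - m b\<^sub>N = -\<Sum> (-1)\<^bsup>|Y|\<^esup> |Y|\<close>; the full alternating sum over all subsets
  of \<open>D\<close> vanishes because \<open>|D| \<noteq> 1\<close>.\<close>

section \<open>The inversion cocycle\<close>

text \<open>The same fold as in \<open>coxeter_length\<close>, so results about words transfer to
  that notion of length.\<close>

definition word_prod :: "('a, 'b) monoid_scheme \<Rightarrow> 'a list \<Rightarrow> 'a" where
  "word_prod G ws = foldr (\<lambda>x y. x \<otimes>\<^bsub>G\<^esub> y) ws \<one>\<^bsub>G\<^esub>"

lemma word_prod_Nil [simp]: "word_prod G [] = \<one>\<^bsub>G\<^esub>"
  and word_prod_Cons [simp]: "word_prod G (x # ws) = x \<otimes>\<^bsub>G\<^esub> word_prod G ws"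
  by (simp_all add: word_prod_def)

context group
begin

lemma word_prod_closed [simp]: "set ws \<subseteq> carrier G \<Longrightarrow> word_prod G ws \<in> carrier G"
  by (induction ws) auto

lemma word_prod_append:
  "set us \<subseteq> carrier G \<Longrightarrow> set vs \<subseteq> carrier G \<Longrightarrow>
    word_prod G (us @ vs) = word_prod G us \<otimes> word_prod G vs"
  by (induction us) (auto simp: m_assoc)

text \<open>Letters are their own inverses, so plain words already form a subgroup. This yields
  countability of a finitely generated image and words for parabolic subgroups.\<close>

lemma generate_involutions:
  assumes "X \<subseteq> carrier G" and "\<And>x. x \<in> X \<Longrightarrow> x \<otimes> x = \<one>"
  shows "generate G X = word_prod G ` lists X"
proof
  show "generate G X \<subseteq> word_prod G ` lists X"
  proof
    fix g assume "g \<in> generate G X"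
    then show "g \<in> word_prod G ` lists X"
    proof induction
      case one
      then show ?case by (intro image_eqI[of _ _ "[]"]) auto
    next
      case (incl h)
      then show ?case using assms(1) by (intro image_eqI[of _ _ "[h]"]) auto
    next
      case (inv h)
      then have "inv h = h"
        using assms by (intro inv_equality) auto
      then show ?case using inv assms(1) by (intro image_eqI[of _ _ "[h]"]) auto
    next
      case (eng h1 h2)
      then obtain us vs where "us \<in> lists X" "vs \<in> lists X"
        "h1 = word_prod G us" "h2 = word_prod G vs" by blast
      then show ?case
        using assms(1) by (intro image_eqI[of _ _ "us @ vs"]) (auto simp: word_prod_append subset_iff)
    qed
  qed
  have "word_prod G ws \<in> generate G X" if "ws \<in> lists X" for ws
    using that by (induction ws) (auto intro: generate.intros)
  then show "word_prod G ` lists X \<subseteq> generate G X" by blast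
qed

lemma mult_inv_cancel [simp]:
  "u \<in> carrier G \<Longrightarrow> x \<in> carrier G \<Longrightarrow> u \<otimes> (inv u \<otimes> x) = x"
  "u \<in> carrier G \<Longrightarrow> x \<in> carrier G \<Longrightarrow> inv u \<otimes> (u \<otimes> x) = x"
  by (simp_all flip: m_assoc)

lemma conj_mult:
  "u \<in> carrier G \<Longrightarrow> v \<in> carrier G \<Longrightarrow> x \<in> carrier G \<Longrightarrow>
    (u \<otimes> v) \<otimes> x \<otimes> inv (u \<otimes> v) = u \<otimes> (v \<otimes> x \<otimes> inv v) \<otimes> inv u"
  by (simp add: inv_mult_group m_assoc)

lemma conj_eq_iff:
  assumes "u \<in> carrier G" "x \<in> carrier G" "y \<in> carrier G"
  shows "u \<otimes> x \<otimes> inv u = y \<longleftrightarrow> x = inv u \<otimes> y \<otimes> u"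
  using assms by (auto simp: m_assoc)

lemma conj_inv_conj [simp]:
  assumes "u \<in> carrier G" "x \<in> carrier G"
  shows "inv u \<otimes> (u \<otimes> x \<otimes> inv u) \<otimes> u = x" "u \<otimes> (inv u \<otimes> x \<otimes> u) \<otimes> inv u = x"
proof -
  show "inv u \<otimes> (u \<otimes> x \<otimes> inv u) \<otimes> u = x"
    using conj_mult[of "inv u" u x] assms by simp
  show "u \<otimes> (inv u \<otimes> x \<otimes> u) \<otimes> inv u = x"
    using conj_mult[of u "inv u" x] assms by simp
qed

end

text \<open>The definition only quantifies over groups on the naturals; since \<open>S\<close> is finite, the image
  generates a countable group, which can be transported there.\<close>

lemma coxeter_system_extend_hom:
  fixes H :: "('b, 'c) monoid_scheme"
  assumes cox: "coxeter_system W S" and fin: "finite S" and H: "group H"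
    and f: "f \<in> S \<rightarrow> carrier H"
    and rel: "\<And>s t k. s \<in> S \<Longrightarrow> t \<in> S \<Longrightarrow> (s \<otimes>\<^bsub>W\<^esub> t) [^]\<^bsub>W\<^esub> (k::nat) = \<one>\<^bsub>W\<^esub> \<Longrightarrow>
                (f s \<otimes>\<^bsub>H\<^esub> f t) [^]\<^bsub>H\<^esub> k = \<one>\<^bsub>H\<^esub>"
  shows "\<exists>h \<in> hom W H. \<forall>s\<in>S. h s = f s"
proof -
  interpret H: group H by (fact H)
  interpret W: group W using cox by (simp add: coxeter_system_def)
  have inv: "s \<otimes>\<^bsub>W\<^esub> s = \<one>\<^bsub>W\<^esub>" if "s \<in> S" for s
    using cox that by (auto simp: coxeter_system_def)
  have SW: "S \<subseteq> carrier W" using cox by (auto simp: coxeter_system_def)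
  define K where "K = generate H (f ` S)"
  have sub: "subgroup K H" unfolding K_def using f by (intro H.generate_is_subgroup) auto
  have finv: "f s \<otimes>\<^bsub>H\<^esub> f s = \<one>\<^bsub>H\<^esub>" if "s \<in> S" for s
  proof -
    have "f s \<in> carrier H" using f that by auto
    \<comment> \<open>The case \<open>s = t\<close>, \<open>k = 1\<close> of \<open>rel\<close>
      makes the images of the generators involutions.\<close>
    then show ?thesis using rel[OF that that, of 1] inv[OF that] by simp
  qed
  have "K = word_prod H ` lists (f ` S)"
    unfolding K_def using f finv by (intro H.generate_involutions) auto
  then have "countable K" using fin by (simp add: countable_finite countable_lists)
  define HK where "HK = H\<lparr>carrier := K\<rparr>"
  \<comment> \<open>An injection into the naturals; \<open>image_group\<close> transports the group
    structure of \<open>K\<close> along it.\<close>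
  define e where "e = to_nat_on K"
  have e: "inj_on e (carrier HK)" using inj_on_to_nat_on[OF \<open>countable K\<close>]
    by (simp add: e_def HK_def)
  interpret HK: group HK using sub H.subgroup_imp_group by (simp add: HK_def)
  interpret I: group "image_group e HK" using HK.inj_imp_image_group_is_group[OF e] .
  have fK: "f s \<in> K" if "s \<in> S" for s using that by (auto simp: K_def intro: generate.incl)
  have ehom: "e \<in> hom HK (image_group e HK)"
    using inj_imp_image_group_iso[OF e] by (simp add: iso_def)
  have HKpow: "x [^]\<^bsub>HK\<^esub> (k::nat) = x [^]\<^bsub>H\<^esub> k" for x k
    by (simp add: HK_def nat_pow_def)
  have "\<exists>h \<in> hom W (image_group e HK). \<forall>s\<in>S. h s = (e \<circ> f) s"
  proof -
    have "(e \<circ> f) \<in> S \<rightarrow> carrier (image_group e HK)"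
      using fK by (auto simp: image_group_carrier HK_def)
    moreover have "((e \<circ> f) s \<otimes>\<^bsub>image_group e HK\<^esub> (e \<circ> f) t) [^]\<^bsub>image_group e HK\<^esub> k
        = \<one>\<^bsub>image_group e HK\<^esub>"
      if st: "s \<in> S" "t \<in> S" and k: "(s \<otimes>\<^bsub>W\<^esub> t) [^]\<^bsub>W\<^esub> k = \<one>\<^bsub>W\<^esub>" for s t and k :: nat
    proof -
      interpret eh: group_hom HK "image_group e HK" e
        using ehom by unfold_locales
      have c: "f s \<in> carrier HK" "f t \<in> carrier HK" using st fK by (auto simp: HK_def)
      have "e ((f s \<otimes>\<^bsub>HK\<^esub> f t) [^]\<^bsub>HK\<^esub> k) = \<one>\<^bsub>image_group e HK\<^esub>"
      proof -
        have "f s \<otimes>\<^bsub>HK\<^esub> f t = f s \<otimes>\<^bsub>H\<^esub> f t" "\<one>\<^bsub>HK\<^esub> = \<one>\<^bsub>H\<^esub>" by (simp_all add: HK_def)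
        then show ?thesis by (simp only: HKpow rel[OF st k] image_group_one)
      qed
      then show ?thesis using c by (simp add: eh.hom_nat_pow)
    qed
    ultimately show ?thesis
      using cox I.is_group unfolding coxeter_system_def by blast
  qed
  then obtain h where h: "h \<in> hom W (image_group e HK)" "\<And>s. s \<in> S \<Longrightarrow> h s = e (f s)"
    by auto
  define g where "g = inv_into K e"
  have ge: "g (e x) = x" if "x \<in> K" for x using e that by (simp add: g_def HK_def)
  have "g \<in> hom (image_group e HK) H"
    using ge ge[unfolded g_def] subgroup.m_closed[OF sub] subgroup.mem_carrier[OF sub]
    by (auto simp: hom_def image_group_def HK_def)
  then have "g \<circ> h \<in> hom W H" using h(1) hom_compose by blast
  moreover have "(g \<circ> h) s = f s" if "s \<in> S" for s using that h(2) fK ge by simp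
  ultimately show ?thesis by blast
qed

text \<open>The semidirect product of \<open>G\<close> with its power set under symmetric difference.\<close>

definition twisted_group :: "('a, 'b) monoid_scheme \<Rightarrow> ('a set \<times> 'a) monoid" where
  "twisted_group G = \<lparr>carrier = Pow (carrier G) \<times> carrier G,
     monoid.mult = (\<lambda>(A, u) (B, v). ({x \<in> carrier G. (x \<in> B) \<noteq> (v \<otimes>\<^bsub>G\<^esub> x \<otimes>\<^bsub>G\<^esub> inv\<^bsub>G\<^esub> v \<in> A)}, u \<otimes>\<^bsub>G\<^esub> v)),
     one = ({}, \<one>\<^bsub>G\<^esub>)\<rparr>"

lemma (in group) twisted_group_is_group: "group (twisted_group G)"
proof (rule groupI)
  fix x y z
  assume "x \<in> carrier (twisted_group G)" "y \<in> carrier (twisted_group G)"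
    "z \<in> carrier (twisted_group G)"
  then show "x \<otimes>\<^bsub>twisted_group G\<^esub> y \<otimes>\<^bsub>twisted_group G\<^esub> z =
       x \<otimes>\<^bsub>twisted_group G\<^esub> (y \<otimes>\<^bsub>twisted_group G\<^esub> z)"
    by (auto simp: twisted_group_def conj_mult) (auto simp: m_assoc)
next
  fix x assume x: "x \<in> carrier (twisted_group G)"
  then obtain A u where [simp]: "x = (A, u)" and "A \<subseteq> carrier G" "u \<in> carrier G"
    by (auto simp: twisted_group_def)
  \<comment> \<open>The left inverse of \<open>(A, u)\<close> is the conjugate set
    \<open>u A u^-1\<close> paired with \<open>u^-1\<close>.\<close>
  then have "({x \<in> carrier G. inv u \<otimes> x \<otimes> u \<in> A}, inv u) \<otimes>\<^bsub>twisted_group G\<^esub> x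
     = \<one>\<^bsub>twisted_group G\<^esub>"
    by (auto simp: twisted_group_def)
  then show "\<exists>y\<in>carrier (twisted_group G). y \<otimes>\<^bsub>twisted_group G\<^esub> x = \<one>\<^bsub>twisted_group G\<^esub>"
    using \<open>u \<in> carrier G\<close>
    by (intro bexI[of _ "({x \<in> carrier G. inv u \<otimes> x \<otimes> u \<in> A}, inv u)"])
       (auto simp: twisted_group_def)
qed (auto simp: twisted_group_def)

text \<open>The word \<open>(s t)^k\<close> has \<open>2 k\<close> letters, and the letter at
  distance \<open>j\<close> from the right end contributes the reflection \<open>t (s t)^j\<close>.
  The first component keeps those met an odd number of times.\<close>

lemma (in group) twisted_group_dihedral_pow:
  fixes k :: nat
  assumes st: "s \<in> carrier G" "t \<in> carrier G" "s \<otimes> s = \<one>" "t \<otimes> t = \<one>"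
  shows "(({s}, s) \<otimes>\<^bsub>twisted_group G\<^esub> ({t}, t)) [^]\<^bsub>twisted_group G\<^esub> k =
    ({x \<in> carrier G. odd (\<Sum>j<2*k. of_bool (t \<otimes> (s \<otimes> t) [^] j = x) :: nat)}, (s \<otimes> t) [^] k)"
proof (induction k)
  case 0
  then show ?case by (simp add: twisted_group_def)
next
  case (Suc k)
  define g where "g = s \<otimes> t"
  have g: "g \<in> carrier G" using st by (simp add: g_def)
  have ig: "inv g = t \<otimes> s"
    using st by (simp add: g_def inv_mult_group inv_equality)
  have igt: "inv g \<otimes> t = t \<otimes> g" using st by (simp add: ig) (simp add: g_def m_assoc)
  \<comment> \<open>Since \<open>t\<close> inverts \<open>g\<close>, conjugating by \<open>g\<close>
    moves the reflection with index \<open>j\<close> to index \<open>j + 2\<close>.\<close>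
  have conj: "t \<otimes> g [^] j = g \<otimes> x \<otimes> inv g \<longleftrightarrow> t \<otimes> g [^] Suc (Suc j) = x"
    if x: "x \<in> carrier G" for x and j :: nat
  proof -
    have "t \<otimes> g [^] j = g \<otimes> x \<otimes> inv g \<longleftrightarrow> inv g \<otimes> (t \<otimes> g [^] j) \<otimes> g = x"
      using conj_eq_iff[of g x "t \<otimes> g [^] j"] x g st by auto
    also have "inv g \<otimes> (t \<otimes> g [^] j) \<otimes> g = (inv g \<otimes> t) \<otimes> g [^] j \<otimes> g"
      using g st by (simp add: m_assoc)
    also have "\<dots> = t \<otimes> (g \<otimes> g [^] j) \<otimes> g"
      unfolding igt using g st by (simp add: m_assoc)
    also have "\<dots> = t \<otimes> g [^] Suc (Suc j)"
      using g st by (simp add: nat_pow_Suc2[symmetric] m_assoc del: nat_pow_Suc)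
    finally show ?thesis .
  qed
  have tst: "x = t \<otimes> g \<longleftrightarrow> t \<otimes> x \<otimes> inv t = s" if "x \<in> carrier G" for x
  proof -
    have "inv t = t" using st by (simp add: inv_equality)
    have "x = t \<otimes> g \<longleftrightarrow> t \<otimes> x = g"
      using that st g \<open>inv t = t\<close> inv_solve_left[of x t g] by auto
    also have "\<dots> \<longleftrightarrow> t \<otimes> x \<otimes> inv t = s"
      unfolding g_def using that st inv_solve_right' m_closed by metis
    finally show ?thesis .
  qed
  have "(({s}, s) \<otimes>\<^bsub>twisted_group G\<^esub> ({t}, t)) = ({x \<in> carrier G. (x = t) \<noteq> (x = t \<otimes> g)}, g)"
    using tst by (auto simp: twisted_group_def g_def)
  then have "(({s}, s) \<otimes>\<^bsub>twisted_group G\<^esub> ({t}, t)) [^]\<^bsub>twisted_group G\<^esub> Suc k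
    = ({x \<in> carrier G. odd (\<Sum>j<2*k. of_bool (t \<otimes> g [^] j = x) :: nat)}, g [^] k)
        \<otimes>\<^bsub>twisted_group G\<^esub> ({x \<in> carrier G. (x = t) \<noteq> (x = t \<otimes> g)}, g)"
    using Suc.IH by (simp add: g_def)
  \<comment> \<open>The old reflections shift to the indices from 2 on; the new factor supplies
    \<open>t\<close> and \<open>t g\<close> at the indices 0 and 1.\<close>
  also have "\<dots> = ({x \<in> carrier G. odd (\<Sum>j<2*Suc k. of_bool (t \<otimes> g [^] j = x) :: nat)}, g [^] Suc k)"
    using g st conj
    by (auto simp: twisted_group_def sum.lessThan_Suc_shift simp del: sum.lessThan_Suc nat_pow_Suc)
  finally show ?case by (simp add: g_def)
qed

text \<open>In terms of words, \<open>N\<close> collects the elements that occur an odd number of times among the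
  reflections \<open>(s\<^sub>i\<^sub>+\<^sub>1 \<cdots> s\<^sub>k)\<^sup>-\<^sup>1 s\<^sub>i (s\<^sub>i\<^sub>+\<^sub>1 \<cdots> s\<^sub>k)\<close>.\<close>

lemma coxeter_system_inversion_cocycle:
  assumes cox: "coxeter_system W D" and fin: "finite D"
  shows "\<exists>N. (\<forall>s\<in>D. N s = {s}) \<and>
    (\<forall>u\<in>carrier W. \<forall>v\<in>carrier W. N (u \<otimes>\<^bsub>W\<^esub> v) =
       {x \<in> carrier W. (x \<in> N v) \<noteq> (v \<otimes>\<^bsub>W\<^esub> x \<otimes>\<^bsub>W\<^esub> inv\<^bsub>W\<^esub> v \<in> N u)})"
proof -
  interpret group W using cox by (simp add: coxeter_system_def)
  have D: "D \<subseteq> carrier W" "generate W D = carrier W"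
    and inv: "\<And>s. s \<in> D \<Longrightarrow> s \<otimes>\<^bsub>W\<^esub> s = \<one>\<^bsub>W\<^esub>"
    using cox by (auto simp: coxeter_system_def)
  have "(({s}, s) \<otimes>\<^bsub>twisted_group W\<^esub> ({t}, t)) [^]\<^bsub>twisted_group W\<^esub> k = \<one>\<^bsub>twisted_group W\<^esub>"
    if st: "s \<in> D" "t \<in> D" and k: "(s \<otimes>\<^bsub>W\<^esub> t) [^]\<^bsub>W\<^esub> (k::nat) = \<one>\<^bsub>W\<^esub>" for s t k
  proof -
    have c: "s \<in> carrier W" "t \<in> carrier W" using st D by auto
    define f :: "'a \<Rightarrow> nat \<Rightarrow> nat" where "f x j = of_bool (t \<otimes>\<^bsub>W\<^esub> (s \<otimes>\<^bsub>W\<^esub> t) [^]\<^bsub>W\<^esub> j = x)" for x j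
    \<comment> \<open>The relation makes the list of reflections periodic with period
      \<open>k\<close>; over \<open>2 k\<close> indices each one is met an even number of times, and
      the first component is empty.\<close>
    have "f x (j + k) = f x j" for x j
      using c k by (simp add: f_def nat_pow_mult[symmetric])
    then have "(\<Sum>j<2*k. f x j) = 2 * (\<Sum>j<k. f x j)" for x
      using sum.shift_bounds_nat_ivl[of "f x" 0 k k] sum.atLeastLessThan_concat[of 0 k "2*k" "f x"]
      by (simp add: mult_2 atLeast0LessThan)
    then show ?thesis
      using twisted_group_dihedral_pow[of s t k] c inv st k unfolding f_def
      by (simp add: twisted_group_def)
  qed
  moreover have "(\<lambda>s. ({s}, s)) \<in> D \<rightarrow> carrier (twisted_group W)"
    using D by (auto simp: twisted_group_def)
  ultimately obtain h where h: "h \<in> hom W (twisted_group W)" "\<And>s. s \<in> D \<Longrightarrow> h s = ({s}, s)"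
    using coxeter_system_extend_hom[OF cox fin twisted_group_is_group, of "\<lambda>s. ({s}, s)"] by blast
  interpret h: group_hom W "twisted_group W" h
    using h(1) twisted_group_is_group by (simp add: group_hom_def group_hom_axioms_def is_group)
  have hmult: "h (u \<otimes>\<^bsub>W\<^esub> v) = h u \<otimes>\<^bsub>twisted_group W\<^esub> h v" if "u \<in> carrier W" "v \<in> carrier W" for u v
    using that by simp
  \<comment> \<open>The second component of \<open>h\<close> is the identity, so the multiplication
    of \<open>twisted_group\<close> turns into the cocycle law for the first component.\<close>
  have snd: "snd (h (word_prod W ws)) = word_prod W ws" if "ws \<in> lists D" for ws
    using that
  proof (induction ws)
    case Nil
    then show ?case using h.hom_one by (simp add: twisted_group_def)
  next
    case (Cons s ws)
    then have "s \<in> carrier W" "word_prod W ws \<in> carrier W" using D by (auto intro!: word_prod_closed)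
    then show ?case using Cons h(2)[of s]
      by (cases "h (word_prod W ws)") (simp add: twisted_group_def)
  qed
  have snd: "snd (h g) = g" if "g \<in> carrier W" for g
  proof -
    have "g \<in> word_prod W ` lists D" using that generate_involutions[OF D(1) inv] D(2) by simp
    then show ?thesis using snd by auto
  qed
  show ?thesis
  proof (intro exI[of _ "fst \<circ> h"] conjI ballI)
    fix u v assume uv: "u \<in> carrier W" "v \<in> carrier W"
    then show "(fst \<circ> h) (u \<otimes>\<^bsub>W\<^esub> v) =
       {x \<in> carrier W. (x \<in> (fst \<circ> h) v) \<noteq> (v \<otimes>\<^bsub>W\<^esub> x \<otimes>\<^bsub>W\<^esub> inv\<^bsub>W\<^esub> v \<in> (fst \<circ> h) u)}"
      using snd[of u] snd[of v] hmult[OF uv]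
      by (cases "h u"; cases "h v") (simp add: twisted_group_def)
  qed (simp add: h(2))
qed

section \<open>Highest coefficients and alternating sums\<close>

text \<open>This is the expansion of a product of factors 1 - 1 over \<open>A\<close>.\<close>

lemma sum_alternating_Pow:
  assumes "finite A" "A \<noteq> {}"
  shows "(\<Sum>X\<in>Pow A. (-1 :: real) ^ card X) = 0"
  using prod_diff_conv_sum[OF assms(1), of "\<lambda>_. 1 :: real" "\<lambda>_. 1"] assms
  by (simp add: power_0_left split: if_splits)

text \<open>Pairing \<open>X\<close> with \<open>insert a X\<close> cancels the cardinalities and
  leaves an alternating sum over the subsets of \<open>B\<close>, which vanishes because
  \<open>B\<close> is nonempty when \<open>card A\<close> is neither 0 nor 1.\<close>

lemma sum_alternating_card_Pow:
  assumes A: "finite A" "card A \<noteq> 1"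
  shows "(\<Sum>X\<in>Pow A. (-1 :: real) ^ card X * real (card X)) = 0"
proof (cases "A = {}")
  case False
  then obtain a B where B: "A = insert a B" "a \<notin> B" by (meson Set.set_insert ex_in_conv)
  have fin: "finite B" "B \<noteq> {}" using A B by auto
  have *: "card (insert a X) = Suc (card X)" if "X \<in> Pow B" for X
    using that B fin by (subst card_insert_disjoint) (auto intro: finite_subset)
  have inj: "inj_on (insert a) (Pow B)" using B(2) by (intro inj_onI) (metis PowD insert_ident subsetD)
  have "(\<Sum>X\<in>Pow A. (-1 :: real) ^ card X * real (card X)) =
    (\<Sum>X\<in>Pow B. (-1) ^ card X * real (card X)) + (\<Sum>X\<in>insert a ` Pow B. (-1) ^ card X * real (card X))"
    unfolding B(1) Pow_insert using B fin by (intro sum.union_disjoint) auto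
  also have "(\<Sum>X\<in>insert a ` Pow B. (-1 :: real) ^ card X * real (card X)) =
     (\<Sum>X\<in>Pow B. - ((-1) ^ card X) * (real (card X) + 1))"
    using inj by (subst sum.reindex) (auto intro!: sum.cong simp: *)
  also have "(\<Sum>X\<in>Pow B. (-1 :: real) ^ card X * real (card X)) + \<dots> = - (\<Sum>X\<in>Pow B. (-1 :: real) ^ card X)"
    by (simp add: sum.distrib[symmetric] sum_negf[symmetric] algebra_simps)
  finally show ?thesis using sum_alternating_Pow[OF fin] by simp
qed simp

text \<open>\<open>p = a t\<^sup>d + b t\<^sup>d\<^sup>-\<^sup>1 + \<dots>\<close>; reading \<open>b\<close> off \<open>t p\<close> forces \<open>b = 0\<close> if \<open>d = 0\<close>.\<close>

definition top_coeffs :: "nat \<Rightarrow> 'a::comm_ring_1 poly \<Rightarrow> 'a \<Rightarrow> 'a \<Rightarrow> bool" where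
  "top_coeffs d p a b \<longleftrightarrow>
     (\<forall>i>d. coeff p i = 0) \<and> coeff p d = a \<and> coeff (pCons 0 p) d = b"

text \<open>No pair of indices other than the two top ones reaches \<open>d + e\<close>. For the
  second coefficient, \<open>t p q\<close> is read as \<open>(t p) q\<close>, where only the indices
  \<open>d\<close> and \<open>d + 1\<close> of \<open>t p\<close> contribute.\<close>

lemma top_coeffs_mult:
  assumes p: "top_coeffs d p a b" and q: "top_coeffs e q a' b'"
  shows "top_coeffs (d + e) (p * q) (a * a') (a * b' + b * a')"
  unfolding top_coeffs_def
proof (intro conjI allI impI)
  fix n assume "n > d + e"
  then have "coeff p i * coeff q (n - i) = 0" if "i \<le> n" for i
    using p q by (cases "i > d") (auto simp: top_coeffs_def)
  then show "coeff (p * q) n = 0" by (simp add: coeff_mult)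
next
  have "coeff (p * q) (d + e) = (\<Sum>i\<in>{d}. coeff p i * coeff q (d + e - i))"
    unfolding coeff_mult
  proof (intro sum.mono_neutral_right ballI)
    fix i assume "i \<in> {..d + e} - {d}"
    then show "coeff p i * coeff q (d + e - i) = 0"
      using p q by (cases "i > d") (auto simp: top_coeffs_def)
  qed auto
  then show "coeff (p * q) (d + e) = a * a'" using p q by (simp add: top_coeffs_def)
next
  have "pCons 0 (p * q) = pCons 0 p * q" by simp
  then have "coeff (pCons 0 (p * q)) (d + e)
      = (\<Sum>i\<le>d + e. coeff (pCons 0 p) i * coeff q (d + e - i))"
    by (simp only: coeff_mult)
  \<comment> \<open>The intersection drops \<open>Suc d\<close> when \<open>e = 0\<close>; then
    \<open>b' = 0\<close>, so the formula still holds.\<close>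
  also have "\<dots> = (\<Sum>i\<in>{d, Suc d} \<inter> {..d + e}. coeff (pCons 0 p) i * coeff q (d + e - i))"
  proof (intro sum.mono_neutral_right ballI)
    fix i assume i: "i \<in> {..d + e} - {d, Suc d} \<inter> {..d + e}"
    show "coeff (pCons 0 p) i * coeff q (d + e - i) = 0"
    proof (cases "i > Suc d")
      case True
      then show ?thesis using p by (simp add: top_coeffs_def coeff_pCons split: nat.split)
    next
      case False
      then show ?thesis using i q by (auto simp: top_coeffs_def)
    qed
  qed auto
  also have "\<dots> = a * b' + b * a'"
  proof (cases e)
    case 0
    then have "{d, Suc d} \<inter> {..d + e} = {d}" by auto
    then show ?thesis using p q 0 by (simp add: top_coeffs_def)
  next
    case (Suc k)
    then have "{d, Suc d} \<inter> {..d + e} = {d, Suc d}" by auto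
    then show ?thesis using p q Suc by (simp add: top_coeffs_def add.commute)
  qed
  finally show "coeff (pCons 0 (p * q)) (d + e) = a * b' + b * a'" .
qed

text \<open>With leading coefficients 1, the product rule for second coefficients becomes
  additive.\<close>

lemma top_coeffs_prod:
  assumes "finite I" "\<And>i. i \<in> I \<Longrightarrow> top_coeffs (d i) (p i) 1 (c i)"
  shows "top_coeffs (\<Sum>i\<in>I. d i) (\<Prod>i\<in>I. p i) 1 (\<Sum>i\<in>I. c i)"
  using assms
proof (induction I rule: finite_induct)
  case empty
  then show ?case by (simp add: top_coeffs_def)
next
  case (insert i I)
  then have "top_coeffs (d i + (\<Sum>i\<in>I. d i)) (p i * (\<Prod>i\<in>I. p i)) (1 * 1) (1 * (\<Sum>i\<in>I. c i) + c i * 1)"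
    by (intro top_coeffs_mult) auto
  with insert.hyps show ?case by (simp add: add.commute)
qed

lemma top_coeffs_sum:
  assumes "\<And>i. i \<in> I \<Longrightarrow> top_coeffs d (p i) (a i) (b i)"
  shows "top_coeffs d (\<Sum>i\<in>I. p i) (\<Sum>i\<in>I. a i) (\<Sum>i\<in>I. b i)"
  using assms by (cases d) (simp_all add: top_coeffs_def coeff_sum)

lemma top_coeffs_monom: "top_coeffs d (monom a d) a 0"
  by (cases d) (simp_all add: top_coeffs_def)

text \<open>Each factor contributes 1 to the second coefficient, which is the source of
  \<open>m\<close> in the final formula.\<close>

lemma top_coeffs_qint:
  assumes "n \<ge> 2"
  shows "top_coeffs (n - 1) (qint n) 1 1"
proof -
  have "coeff (qint n) i = (if i < n then 1 else 0)" for i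
    by (simp add: qint_def coeff_sum)
  moreover obtain k where "n = Suc (Suc k)"
    using assms by (metis add_2_eq_Suc le_Suc_ex)
  ultimately show ?thesis by (simp add: top_coeffs_def)
qed

text \<open>Degrees add over a domain, which bounds the degree of \<open>q\<close>; the product rule
  is then solved for its coefficients.\<close>

lemma top_coeffs_mult_cancel:
  fixes p q :: "'a::idom poly"
  assumes p: "top_coeffs d p 1 b" and pq: "top_coeffs (d + e) (p * q) a' b'"
  shows "top_coeffs e q a' (b' - b * a')"
proof -
  have "p \<noteq> 0" using p by (auto simp: top_coeffs_def)
  have "degree p = d"
    using p by (intro antisym degree_le le_degree) (auto simp: top_coeffs_def)
  have "coeff q i = 0" if "i > e" for i
  proof (cases "q = 0")
    case False
    then have "degree (p * q) = d + degree q" using \<open>p \<noteq> 0\<close> \<open>degree p = d\<close> by (simp add: degree_mult_eq)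
    moreover have "degree (p * q) \<le> d + e"
      using pq by (intro degree_le) (auto simp: top_coeffs_def)
    ultimately show ?thesis using that by (intro coeff_eq_0) simp
  qed simp
  then have q: "top_coeffs e q (coeff q e) (coeff (pCons 0 q) e)" by (simp add: top_coeffs_def)
  from top_coeffs_mult[OF p q] pq
  have "a' = coeff q e" "b' = coeff (pCons 0 q) e + b * coeff q e" by (auto simp: top_coeffs_def)
  with q show ?thesis by simp
qed

section \<open>Length and parabolic subgroups\<close>

text \<open>The Coxeter relations enter only through the cocycle \<open>N\<close>. The set
  \<open>N g\<close> plays the role of the inversions of \<open>g\<close>, and its cardinality is
  shown to be the word length.\<close>

locale finite_coxeter_cocycle = group W for W :: "'w monoid" (structure) +
  fixes D :: "'w set" and N :: "'w \<Rightarrow> 'w set"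
  assumes D_carrier: "D \<subseteq> carrier W" and finite_D: "finite D"
    and D_square: "s \<in> D \<Longrightarrow> s \<otimes> s = \<one>"
    and generate_D: "generate W D = carrier W"
    and N_gen: "s \<in> D \<Longrightarrow> N s = {s}"
    and N_mult: "u \<in> carrier W \<Longrightarrow> v \<in> carrier W \<Longrightarrow>
      N (u \<otimes> v) = {x \<in> carrier W. (x \<in> N v) \<noteq> (v \<otimes> x \<otimes> inv v \<in> N u)}"
begin

abbreviation len :: "'w \<Rightarrow> nat" where "len g \<equiv> card (N g)"

abbreviation parabolic :: "'w set \<Rightarrow> 'w set" where "parabolic Y \<equiv> generate W Y"

lemma parabolic_eq: "Y \<subseteq> D \<Longrightarrow> parabolic Y = word_prod W ` lists Y"
  using D_carrier D_square by (intro generate_involutions) auto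

lemma parabolic_subgroup: "Y \<subseteq> D \<Longrightarrow> subgroup (parabolic Y) W"
  using D_carrier by (intro generate_is_subgroup) auto

lemma parabolic_carrier: "Y \<subseteq> D \<Longrightarrow> g \<in> parabolic Y \<Longrightarrow> g \<in> carrier W"
  by (rule subgroup.mem_carrier[OF parabolic_subgroup])

lemma word_carrier: "Y \<subseteq> D \<Longrightarrow> ws \<in> lists Y \<Longrightarrow> word_prod W ws \<in> carrier W"
  using D_carrier by (intro word_prod_closed) auto

lemma inv_gen: "s \<in> D \<Longrightarrow> inv s = s"
  using D_carrier D_square by (intro inv_equality) auto

lemma N_one [simp]: "N \<one> = {}"
proof -
  have "N (\<one> \<otimes> \<one>) = {}" by (subst N_mult) auto
  then show ?thesis by simp
qed

lemma N_carrier: "g \<in> carrier W \<Longrightarrow> N g \<subseteq> carrier W"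
proof -
  assume g: "g \<in> carrier W"
  then have "N (g \<otimes> \<one>) \<subseteq> carrier W" by (subst N_mult) auto
  then show ?thesis using g by simp
qed

text \<open>Prefixing a letter toggles exactly one reflection.\<close>

lemma N_gen_mult:
  "s \<in> D \<Longrightarrow> g \<in> carrier W \<Longrightarrow>
    N (s \<otimes> g) = {x \<in> carrier W. (x \<in> N g) \<noteq> (x = inv g \<otimes> s \<otimes> g)}"
proof -
  assume s: "s \<in> D" and g: "g \<in> carrier W"
  then have "s \<in> carrier W" using D_carrier by auto
  then have "g \<otimes> x \<otimes> inv g = s \<longleftrightarrow> x = inv g \<otimes> s \<otimes> g" if "x \<in> carrier W" for x
    using that g by (intro conj_eq_iff)
  then show ?thesis using N_mult[of s g] s g \<open>s \<in> carrier W\<close> by (auto simp: N_gen)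
qed

lemma N_parabolic:
  assumes Y: "Y \<subseteq> D" and "g \<in> parabolic Y"
  shows "N g \<subseteq> parabolic Y"
proof -
  interpret P: subgroup "parabolic Y" W by (rule parabolic_subgroup[OF Y])
  have "N (word_prod W ws) \<subseteq> parabolic Y" if "ws \<in> lists Y" for ws
    using that
  proof (induction ws)
    case (Cons s ws)
    define g where "g = word_prod W ws"
    have g: "g \<in> parabolic Y" unfolding g_def parabolic_eq[OF Y] using Cons by blast
    have s: "s \<in> D" "s \<in> parabolic Y" using Cons Y by (auto intro: generate.incl)
    have "inv g \<otimes> s \<otimes> g \<in> parabolic Y" using g s by simp
    then show ?case
      using Cons.IH Cons.hyps N_gen_mult[OF s(1) P.mem_carrier[OF g]] unfolding g_def by auto
  qed simp
  then show ?thesis using assms(2) unfolding parabolic_eq[OF Y] by auto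
qed

text \<open>An inversion \<open>t\<close> must have been toggled by some letter; deleting that
  letter multiplies the product by \<open>t\<close> on the right. Deletion keeps the word over
  \<open>Y\<close>.\<close>

lemma strong_exchange:
  assumes Y: "Y \<subseteq> D" and "ws \<in> lists Y" "t \<in> N (word_prod W ws)"
  shows "\<exists>ws'\<in>lists Y. word_prod W ws' = word_prod W ws \<otimes> t \<and> length ws' < length ws"
  using assms(2,3)
proof (induction ws)
  case (Cons s ws)
  define g where "g = word_prod W ws"
  have g: "g \<in> carrier W" using Cons.hyps word_carrier[OF Y] by (simp add: g_def)
  have s: "s \<in> D" "s \<in> carrier W" using Cons Y D_carrier by auto
  have t: "t \<in> carrier W" "(t \<in> N g) \<noteq> (t = inv g \<otimes> s \<otimes> g)"
    using Cons.prems s g by (auto simp: N_gen_mult g_def)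
  show ?case
  proof (cases "t \<in> N g")
    case True
    then obtain vs where "vs \<in> lists Y" "word_prod W vs = g \<otimes> t" "length vs < length ws"
      using Cons.IH g_def by blast
    then show ?thesis using Cons.hyps s g t
      by (intro bexI[of _ "s # vs"]) (auto simp: m_assoc g_def)
  next
    case False
    then have "t = inv g \<otimes> s \<otimes> g" using t by simp
    then have "s \<otimes> g \<otimes> t = (s \<otimes> s) \<otimes> g"
      using s g by (simp add: m_assoc)
    then show ?thesis using Cons.hyps D_square[OF s(1)] g
      by (intro bexI[of _ ws]) (auto simp: g_def)
  qed
qed simp

text \<open>Each letter toggles one reflection, so \<open>len\<close> is at most the word length. In
  a shortest word no reflection is ever toggled off, since \<open>strong_exchange\<close> would
  shorten the word.\<close>

lemma card_N_word:
  assumes Y: "Y \<subseteq> D" and "ws \<in> lists Y"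
  shows "finite (N (word_prod W ws)) \<and> len (word_prod W ws) \<le> length ws \<and>
    ((\<forall>vs\<in>lists Y. word_prod W vs = word_prod W ws \<longrightarrow> length ws \<le> length vs)
      \<longrightarrow> len (word_prod W ws) = length ws)"
  using assms(2)
proof (induction ws)
  case (Cons s ws)
  define g where "g = word_prod W ws"
  define r where "r = inv g \<otimes> s \<otimes> g"
  have g: "g \<in> carrier W" using Cons.hyps word_carrier[OF Y] by (simp add: g_def)
  have s: "s \<in> D" "s \<in> carrier W" using Cons Y D_carrier by auto
  have r: "r \<in> carrier W" using s g by (simp add: r_def)
  have gr: "g \<otimes> r = s \<otimes> g"
    using g s by (simp add: r_def m_assoc)
  have N: "N (s \<otimes> g) = (if r \<in> N g then N g - {r} else insert r (N g))"
    using N_gen_mult[OF s(1) g] N_carrier[OF g] r by (auto simp: r_def)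
  have fin: "finite (N g)" "len g \<le> length ws" using Cons.IH by (auto simp: g_def)
  have "len (s \<otimes> g) = length (s # ws)"
    if min: "\<forall>vs\<in>lists Y. word_prod W vs = s \<otimes> g \<longrightarrow> length (s # ws) \<le> length vs"
  proof -
    \<comment> \<open>Otherwise \<open>g r = s g\<close> would have a word even shorter than the
      tail \<open>ws\<close>.\<close>
    have "r \<notin> N g"
    proof
      assume "r \<in> N g"
      then obtain vs where "vs \<in> lists Y" "word_prod W vs = s \<otimes> g" "length vs < length ws"
        using strong_exchange[OF Y Cons.hyps(2), of r] gr by (auto simp: g_def)
      then show False using min by force
    qed
    moreover have "len g = length ws"
    proof -
      \<comment> \<open>The tail of a shortest word is itself shortest, as prefixing
        \<open>s\<close> to a rival shows.\<close>
      have "length ws \<le> length vs" if "vs \<in> lists Y" "word_prod W vs = g" for vs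
        using min[rule_format, of "s # vs"] that Cons.hyps by auto
      then show ?thesis using Cons.IH unfolding g_def by blast
    qed
    ultimately show ?thesis using N fin by simp
  qed
  moreover have "finite (N (s \<otimes> g))" "len (s \<otimes> g) \<le> length (s # ws)"
    using N fin card_Diff1_le[of "N g" r] by (auto simp: card_insert_if intro: le_SucI order_trans)
  ultimately show ?case by (simp add: g_def)
qed simp

text \<open>As \<open>len\<close> does not depend on \<open>Y\<close>, this shows that length within
  a parabolic subgroup agrees with length in \<open>W\<close>.\<close>

lemma reduced_word:
  assumes Y: "Y \<subseteq> D" and g: "g \<in> parabolic Y"
  obtains ws where "ws \<in> lists Y" "word_prod W ws = g" "length ws = len g"
proof -
  obtain us where "us \<in> lists Y" "word_prod W us = g"
    using g unfolding parabolic_eq[OF Y] by auto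
  then obtain ws where ws: "ws \<in> lists Y" "word_prod W ws = g"
    "\<And>vs. vs \<in> lists Y \<and> word_prod W vs = g \<Longrightarrow> length ws \<le> length vs"
    using ex_has_least_nat[of "\<lambda>ws. ws \<in> lists Y \<and> word_prod W ws = g" us length] by metis
  have "len g = length ws" using card_N_word[OF Y ws(1)] ws(2,3) by simp
  then show thesis using that[OF ws(1,2)] by simp
qed

lemma coxeter_length_eq_len:
  assumes "g \<in> carrier W"
  shows "coxeter_length W D g = len g"
proof -
  obtain ws where ws: "ws \<in> lists D" "word_prod W ws = g" "length ws = len g"
    using reduced_word[of D g] assms generate_D by (metis order_refl)
  have "len g \<le> length vs" if "vs \<in> lists D" "word_prod W vs = g" for vs
    using card_N_word[OF order_refl that(1)] that(2) by simp
  then show ?thesis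
    using ws unfolding coxeter_length_def word_prod_def[symmetric]
    by (intro Least_equality) auto
qed

lemma finite_N:
  assumes "g \<in> carrier W"
  shows "finite (N g)"
proof -
  obtain ws where ws: "ws \<in> lists D" "word_prod W ws = g" "length ws = len g"
    using reduced_word[OF order_refl] assms generate_D by metis
  then show ?thesis using card_N_word[OF order_refl ws(1)] by simp
qed

lemma bij_betw_conj_N:
  assumes "u \<in> carrier W" "v \<in> carrier W"
  shows "bij_betw (\<lambda>y. inv v \<otimes> y \<otimes> v) (N u) {x \<in> carrier W. v \<otimes> x \<otimes> inv v \<in> N u}"
  using assms N_carrier[OF assms(1)]
  by (intro bij_betw_byWitness[of _ "\<lambda>x. v \<otimes> x \<otimes> inv v"]) (auto simp: subset_iff)

text \<open>The cocycle law makes \<open>N (u \<otimes> v)\<close> the symmetric difference of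
  \<open>N v\<close> and a conjugate of \<open>N u\<close>; when these are disjoint, cardinalities
  add.\<close>

lemma len_mult_disjoint:
  assumes u: "u \<in> carrier W" and v: "v \<in> carrier W"
    and disj: "\<And>x. x \<in> N v \<Longrightarrow> v \<otimes> x \<otimes> inv v \<notin> N u"
  shows "len (u \<otimes> v) = len u + len v"
proof -
  let ?A = "{x \<in> carrier W. v \<otimes> x \<otimes> inv v \<in> N u}"
  have A: "finite ?A" "card ?A = len u"
    using bij_betw_finite[OF bij_betw_conj_N[OF u v]] bij_betw_same_card[OF bij_betw_conj_N[OF u v]]
      finite_N[OF u] by simp_all
  have "N (u \<otimes> v) = N v \<union> ?A" "N v \<inter> ?A = {}"
    using N_mult[OF u v] disj N_carrier[OF v] by blast+
  then show ?thesis using A finite_N[OF v] by (simp add: card_Un_disjoint)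
qed

lemma len_mult_le:
  assumes u: "u \<in> carrier W" and v: "v \<in> carrier W"
  shows "len (u \<otimes> v) \<le> len u + len v"
proof -
  let ?A = "{x \<in> carrier W. v \<otimes> x \<otimes> inv v \<in> N u}"
  have A: "finite ?A" "card ?A = len u"
    using bij_betw_finite[OF bij_betw_conj_N[OF u v]] bij_betw_same_card[OF bij_betw_conj_N[OF u v]]
      finite_N[OF u] by simp_all
  have "N (u \<otimes> v) \<subseteq> N v \<union> ?A" using N_mult[OF u v] by blast
  then have "len (u \<otimes> v) \<le> card (N v \<union> ?A)" using A(1) finite_N[OF v] by (intro card_mono) auto
  also have "\<dots> \<le> len v + len u" using card_Un_le[of "N v" ?A] A(2) by simp
  finally show ?thesis by simp
qed

lemma len_mult_less:
  assumes g: "g \<in> carrier W" and t: "t \<in> N g"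
  shows "len (g \<otimes> t) < len g"
proof -
  obtain ws where ws: "ws \<in> lists D" "word_prod W ws = g" "length ws = len g"
    using reduced_word[OF order_refl] g generate_D by metis
  obtain vs where vs: "vs \<in> lists D" "word_prod W vs = g \<otimes> t" "length vs < length ws"
    using strong_exchange[OF order_refl ws(1), of t] ws(2) t by auto
  then show ?thesis using card_N_word[OF order_refl vs(1)] ws(3) by simp
qed

section \<open>Right descents and last letters of reduced words\<close>

lemma len_eq_0_iff [simp]:
  assumes g: "g \<in> carrier W"
  shows "len g = 0 \<longleftrightarrow> g = \<one>"
proof
  assume "len g = 0"
  then obtain ws where "ws \<in> lists D" "word_prod W ws = g" "length ws = 0"
    using reduced_word[OF order_refl] g generate_D by metis
  then show "g = \<one>" by simp
qed simp

text \<open>For a generator, membership in \<open>N g\<close> means being a right descent.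
  Conjugation by \<open>s\<close> fixes \<open>s\<close>, so multiplying by \<open>s\<close> flips
  this membership.\<close>

lemma len_mult_gen:
  assumes g: "g \<in> carrier W" and s: "s \<in> D"
  shows "len (g \<otimes> s) = (if s \<in> N g then len g - 1 else len g + 1)"
    and "s \<in> N (g \<otimes> s) \<longleftrightarrow> s \<notin> N g"
proof -
  have sc: "s \<in> carrier W" using s D_carrier by blast
  have len_s: "len s = 1" using N_gen[OF s] by simp
  show "s \<in> N (g \<otimes> s) \<longleftrightarrow> s \<notin> N g"
    using N_mult[OF g sc] N_gen[OF s] sc by (auto simp: m_assoc)
  show "len (g \<otimes> s) = (if s \<in> N g then len g - 1 else len g + 1)"
  proof (cases "s \<in> N g")
    case True
    have "len (g \<otimes> s \<otimes> s) \<le> len (g \<otimes> s) + 1"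
      using len_mult_le[of "g \<otimes> s" s] g sc len_s by simp
    moreover have "g \<otimes> s \<otimes> s = g" using g sc D_square[OF s] by (simp add: m_assoc)
    ultimately show ?thesis using len_mult_less[OF g True] True by simp
  next
    case False
    have "len (g \<otimes> s) = len g + len s"
      using len_mult_disjoint[OF g sc] N_gen[OF s] False sc by (simp add: m_assoc)
    then show ?thesis using False len_s by simp
  qed
qed

lemma last_letter:
  assumes Y: "Y \<subseteq> D" and g: "g \<in> parabolic Y" "g \<noteq> \<one>"
  obtains g' s where "g' \<in> parabolic Y" "s \<in> Y" "g = g' \<otimes> s" "len g = Suc (len g')"
    "s \<in> N g" "s \<notin> N g'"
proof -
  obtain ws where ws: "ws \<in> lists Y" "word_prod W ws = g" "length ws = len g"
    using reduced_word[OF Y g(1)] by metis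
  have "ws \<noteq> []" using ws(2) g(2) by auto
  then obtain us s where us: "ws = us @ [s]" by (metis rev_exhaust)
  have s: "s \<in> Y" "s \<in> D" "s \<in> carrier W" and usY: "us \<in> lists Y" using us ws(1) Y D_carrier by auto
  define g' where "g' = word_prod W us"
  have g': "g' \<in> parabolic Y" unfolding g'_def parabolic_eq[OF Y] using usY by blast
  then have g'c: "g' \<in> carrier W" by (rule parabolic_carrier[OF Y])
  have eq: "g = g' \<otimes> s"
    using word_prod_append[of us "[s]"] us ws(2) s usY Y D_carrier by (auto simp: g'_def subset_iff)
  have "len g' < len g" using card_N_word[OF Y usY] us ws(3) by (simp add: g'_def)
  then have "s \<notin> N g'" "len g = Suc (len g')" "s \<in> N g"
    using len_mult_gen[OF g'c s(2)] eq by (auto split: if_splits)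
  with that g' s(1) eq show thesis by blast
qed

lemma len_eq_1_iff:
  assumes Y: "Y \<subseteq> D" and g: "g \<in> parabolic Y"
  shows "len g = 1 \<longleftrightarrow> g \<in> Y"
proof
  assume "g \<in> Y"
  then show "len g = 1" using Y by (simp add: N_gen subsetD)
next
  assume len: "len g = 1"
  then have "g \<noteq> \<one>" by auto
  then obtain g' s where g': "g' \<in> parabolic Y" "s \<in> Y" "g = g' \<otimes> s" "len g = Suc (len g')"
    using last_letter[OF Y g] by metis
  then have "g' = \<one>" using len parabolic_carrier[OF Y g'(1)] by simp
  then show "g \<in> Y" using g' Y D_carrier by auto
qed

lemma descents_empty_iff:
  assumes g: "g \<in> carrier W"
  shows "D \<inter> N g = {} \<longleftrightarrow> g = \<one>"
proof
  assume "D \<inter> N g = {}"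
  show "g = \<one>"
  proof (rule ccontr)
    assume "g \<noteq> \<one>"
    then obtain g' s where "s \<in> D" "s \<in> N g"
      using last_letter[OF order_refl, of g] g generate_D by metis
    then show False using \<open>D \<inter> N g = {}\<close> by blast
  qed
qed simp

section \<open>Cosets of parabolic subgroups\<close>

text \<open>These are the shortest elements of the cosets u W_Y, encoded by the absence of
  inversions inside W_Y.\<close>

definition min_coset_reps :: "'w set \<Rightarrow> 'w set" where
  "min_coset_reps Y = {u \<in> carrier W. N u \<inter> parabolic Y = {}}"

text \<open>An inversion of \<open>w\<close> lying in W_Y shortens \<open>w\<close> without leaving
  its coset, so induction on length ends at a minimal representative.\<close>

lemma coset_decomposition:
  assumes Y: "Y \<subseteq> D" and "w \<in> carrier W"
  shows "\<exists>u\<in>min_coset_reps Y. \<exists>v\<in>parabolic Y. w = u \<otimes> v"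
  using assms(2)
proof (induction "len w" arbitrary: w rule: less_induct)
  case less
  show ?case
  proof (cases "N w \<inter> parabolic Y = {}")
    case True
    then show ?thesis using less.prems generate.one[of W Y]
      by (intro bexI[of _ w] bexI[of _ \<one>]) (auto simp: min_coset_reps_def)
  next
    case False
    then obtain t where t: "t \<in> N w" "t \<in> parabolic Y" by blast
    have tc: "t \<in> carrier W" by (rule parabolic_carrier[OF Y t(2)])
    obtain u v where uv: "u \<in> min_coset_reps Y" "v \<in> parabolic Y" "w \<otimes> t = u \<otimes> v"
      using less.hyps[OF len_mult_less[OF less.prems t(1)]] less.prems tc by auto
    have "v \<in> carrier W" by (rule parabolic_carrier[OF Y uv(2)])
    moreover have "u \<in> carrier W" using uv(1) by (simp add: min_coset_reps_def)
    ultimately have "w = u \<otimes> (v \<otimes> inv t)"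
      using uv(3) less.prems tc by (metis inv_closed inv_solve_right m_assoc m_closed)
    moreover have "v \<otimes> inv t \<in> parabolic Y"
      using uv(2) t(2) parabolic_subgroup[OF Y] by (simp add: subgroup.m_closed subgroup.m_inv_closed)
    ultimately show ?thesis using uv(1) by blast
  qed
qed

text \<open>Conjugation by \<open>v\<close> preserves W_Y, where \<open>u\<close> has no inversions;
  hence the inversions coming from \<open>u\<close> stay outside W_Y and lengths add.\<close>

lemma coset_inversions:
  assumes Y: "Y \<subseteq> D" and u: "u \<in> min_coset_reps Y" and v: "v \<in> parabolic Y"
  shows "N (u \<otimes> v) \<inter> parabolic Y = N v" and "len (u \<otimes> v) = len u + len v"
proof -
  interpret P: subgroup "parabolic Y" W by (rule parabolic_subgroup[OF Y])
  have uc: "u \<in> carrier W" using u by (simp add: min_coset_reps_def)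
  have vc: "v \<in> carrier W" by (rule parabolic_carrier[OF Y v])
  have conj: "v \<otimes> x \<otimes> inv v \<notin> N u" if "x \<in> parabolic Y" for x
  proof -
    have "v \<otimes> x \<otimes> inv v \<in> parabolic Y" using v that by simp
    then show ?thesis using u unfolding min_coset_reps_def by blast
  qed
  have Nv: "N v \<subseteq> parabolic Y" by (rule N_parabolic[OF Y v])
  show "N (u \<otimes> v) \<inter> parabolic Y = N v"
    using N_mult[OF uc vc] Nv conj P.subset by auto
  show "len (u \<otimes> v) = len u + len v"
    using Nv conj by (intro len_mult_disjoint uc vc) blast
qed

lemma coset_decomposition_unique:
  assumes Y: "Y \<subseteq> D" and u: "u \<in> min_coset_reps Y" "u' \<in> min_coset_reps Y"
    and v: "v \<in> parabolic Y" "v' \<in> parabolic Y" and eq: "u \<otimes> v = u' \<otimes> v'"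
  shows "u = u' \<and> v = v'"
proof -
  interpret P: subgroup "parabolic Y" W by (rule parabolic_subgroup[OF Y])
  have c: "u \<in> carrier W" "u' \<in> carrier W" "v \<in> carrier W" "v' \<in> carrier W"
    using u parabolic_carrier[OF Y] v by (simp_all add: min_coset_reps_def)
  define a where "a = v' \<otimes> inv v"
  have a: "a \<in> parabolic Y" "inv a \<in> parabolic Y" "a \<in> carrier W" using v c by (simp_all add: a_def)
  have ua: "u = u' \<otimes> a" using eq c unfolding a_def by (metis inv_closed inv_solve_right m_assoc m_closed)
  then have ua': "u' = u \<otimes> inv a" using c a(3) by (simp add: m_assoc)
  \<comment> \<open>Additivity in both directions between two minimal representatives forces
    \<open>len a = 0\<close>.\<close>
  have "len u = len u' + len a" "len u' = len u + len (inv a)"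
    using coset_inversions(2)[OF Y u(2) a(1), folded ua]
      coset_inversions(2)[OF Y u(1) a(2), folded ua'] by simp_all
  then have "a = \<one>" using a(3) by simp
  then have "u = u'" using ua c by simp
  then show ?thesis using eq c by simp
qed

text \<open>Every reduced word can be completed on the left to a reduced word of \<open>v\<close>: exchanging a
  further letter into \<open>v = x g'\<close> cannot delete a letter of the reduced word for \<open>g'\<close>.\<close>

lemma len_complement:
  assumes Y: "Y \<subseteq> D" and v: "v \<in> parabolic Y" and desc: "Y \<subseteq> N v" and g: "g \<in> parabolic Y"
  shows "len v = len (v \<otimes> inv g) + len g"
  using g
proof (induction "len g" arbitrary: g rule: less_induct)
  case less
  interpret P: subgroup "parabolic Y" W by (rule parabolic_subgroup[OF Y])
  have vc: "v \<in> carrier W" by (rule parabolic_carrier[OF Y v])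
  show ?case
  proof (cases "g = \<one>")
    case True
    then show ?thesis using vc by simp
  next
    case False
    then obtain g' s where g': "g' \<in> parabolic Y" "s \<in> Y" "g = g' \<otimes> s" "len g = Suc (len g')"
      "s \<notin> N g'" using last_letter[OF Y less.prems] by metis
    have c: "g' \<in> carrier W" by (rule parabolic_carrier[OF Y g'(1)])
    have s: "s \<in> D" "s \<in> carrier W" using g'(2) Y D_carrier by auto
    define x where "x = v \<otimes> inv g'"
    define t where "t = g' \<otimes> s \<otimes> inv g'"
    have xc: "x \<in> carrier W" and tc: "t \<in> carrier W" using vc c s by (simp_all add: x_def t_def)
    have vx: "v = x \<otimes> g'" using vc c by (simp add: x_def m_assoc)
    have IH: "len v = len x + len g'" using less.hyps[of g'] g' by (simp add: x_def)
    \<comment> \<open>The descent \<open>s\<close> of \<open>v\<close> is not an inversion of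
      \<open>g'\<close>, so by the cocycle law its conjugate \<open>t\<close> must be one of
      \<open>x\<close>.\<close>
    have "s \<in> N (x \<otimes> g')" using desc g'(2) vx by blast
    then have "t \<in> N x" using g'(5) N_mult[OF xc c] by (simp add: t_def)
    then have less_x: "len (x \<otimes> t) < len x" by (rule len_mult_less[OF xc])
    have xt: "x \<otimes> t = v \<otimes> inv g"
      using vc c s inv_gen[OF s(1)] by (simp add: x_def t_def g'(3) m_assoc inv_mult_group)
    have gc: "g \<in> carrier W" using c s g'(3) by simp
    have "len (v \<otimes> inv g \<otimes> g) \<le> len (v \<otimes> inv g) + len g"
      using vc gc by (intro len_mult_le) simp_all
    moreover have "v \<otimes> inv g \<otimes> g = v" using vc gc by (simp add: m_assoc)
    \<comment> \<open>The strict drop from \<open>x\<close> to \<open>x t\<close> gives one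
      inequality, subadditivity of length the other.\<close>
    ultimately show ?thesis using less_x IH xt g'(4) by simp
  qed
qed

section \<open>Finite parabolic subgroups and their longest elements\<close>

lemma finite_len_eq: "finite {w \<in> carrier W. len w = k}"
proof (rule finite_subset)
  show "{w \<in> carrier W. len w = k} \<subseteq> word_prod W ` {ws. set ws \<subseteq> D \<and> length ws = k}"
  proof
    fix w assume w: "w \<in> {w \<in> carrier W. len w = k}"
    then obtain ws where "ws \<in> lists D" "word_prod W ws = w" "length ws = len w"
      using reduced_word[OF order_refl] generate_D by (metis (no_types, lifting) mem_Collect_eq)
    then show "w \<in> word_prod W ` {ws. set ws \<subseteq> D \<and> length ws = k}" using w by auto
  qed
  show "finite (word_prod W ` {ws. set ws \<subseteq> D \<and> length ws = k})"
    using finite_D by (intro finite_imageI finite_lists_length_eq)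
qed

text \<open>The parabolic part \<open>v\<close> of \<open>w\<close> inherits the descents
  \<open>Y\<close>, so by \<open>len_complement\<close> its length bounds all lengths in W_Y; each
  length occurs finitely often.\<close>

lemma finite_parabolic_if_descents:
  assumes Y: "Y \<subseteq> D" and w: "w \<in> carrier W" "Y \<subseteq> N w"
  shows "finite (parabolic Y)"
proof -
  obtain u v where uv: "u \<in> min_coset_reps Y" "v \<in> parabolic Y" "w = u \<otimes> v"
    using coset_decomposition[OF Y w(1)] by blast
  have "Y \<subseteq> parabolic Y" by (auto intro: generate.incl)
  then have "Y \<subseteq> N v" using coset_inversions(1)[OF Y uv(1,2)] w(2) uv(3) by blast
  then have "len g \<le> len v" if "g \<in> parabolic Y" for g
    using len_complement[OF Y uv(2) _ that] by simp
  then have "parabolic Y \<subseteq> (\<Union>k\<in>{..len v}. {w \<in> carrier W. len w = k})"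
    using parabolic_carrier[OF Y] by auto
  then show ?thesis by (rule finite_subset) (simp add: finite_len_eq)
qed

text \<open>An element of maximal length works: a generator that is not a descent would lengthen
  it.\<close>

lemma longest_element_exists:
  assumes Y: "Y \<subseteq> D" and fin: "finite (parabolic Y)"
  obtains v where "v \<in> parabolic Y" "Y \<subseteq> N v"
proof -
  interpret P: subgroup "parabolic Y" W by (rule parabolic_subgroup[OF Y])
  obtain v where v: "v \<in> parabolic Y" "\<And>g. g \<in> parabolic Y \<Longrightarrow> len g \<le> len v"
  proof -
    have "parabolic Y \<noteq> {}" using P.one_closed by blast
    then have "Max (len ` parabolic Y) \<in> len ` parabolic Y" using fin by (intro Max_in) auto
    then obtain v where "v \<in> parabolic Y" "len v = Max (len ` parabolic Y)" by auto
    with fin that show thesis by simp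
  qed
  have "Y \<subseteq> N v"
  proof
    fix s assume s: "s \<in> Y"
    then have "v \<otimes> s \<in> parabolic Y" using v(1) by (simp add: generate.incl)
    then have "len (v \<otimes> s) \<le> len v" by (rule v(2))
    then show "s \<in> N v" using len_mult_gen(1)[OF parabolic_carrier[OF Y v(1)], of s] s Y
      by (auto split: if_splits)
  qed
  then show thesis using v(1) that by blast
qed

section \<open>Growth series\<close>

text \<open>The series A_Y(t) of the opening outline; \<open>Y = {}\<close> gives W(t).\<close>

definition descent_series :: "'w set \<Rightarrow> real fps" where
  "descent_series Y = Abs_fps (\<lambda>k. real (card {w \<in> carrier W. len w = k \<and> Y \<subseteq> N w}))"

definition coset_series :: "'w set \<Rightarrow> real fps" where
  "coset_series Y = Abs_fps (\<lambda>k. real (card {u \<in> min_coset_reps Y. len u = k}))"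

text \<open>This is W_Y(t) when W_Y is finite; over an infinite index set the sum would default to
  0.\<close>

definition parabolic_poly :: "'w set \<Rightarrow> real poly" where
  "parabolic_poly Y = (\<Sum>g\<in>parabolic Y. monom 1 (len g))"

lemma poincare_series_eq: "poincare_series W D = descent_series {}"
proof -
  have "{g \<in> carrier W. coxeter_length W D g = k} = {w \<in> carrier W. len w = k \<and> {} \<subseteq> N w}" for k
    using coxeter_length_eq_len by auto
  then show ?thesis by (simp add: poincare_series_def descent_series_def)
qed

lemma min_coset_reps_carrier: "u \<in> min_coset_reps Y \<Longrightarrow> u \<in> carrier W"
  by (simp add: min_coset_reps_def)

lemma coset_series_shift_nth:
  "fps_nth (coset_series Y * fps_X ^ d) k = real (card {u \<in> min_coset_reps Y. len u + d = k})"
proof (cases "k < d")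
  case True
  then have "{u \<in> min_coset_reps Y. len u + d = k} = {}" by auto
  then show ?thesis using True by (simp only: fps_X_power_mult_right_nth if_True card.empty of_nat_0)
next
  case False
  then have "{u \<in> min_coset_reps Y. len u + d = k} = {u \<in> min_coset_reps Y. len u = k - d}" by auto
  then show ?thesis using False by (simp add: fps_X_power_mult_right_nth coset_series_def)
qed

text \<open>Multiplication of minimal coset representatives by elements of W_Y is a length-additive
  bijection onto \<open>W\<close>.\<close>

lemma length_series_factor:
  assumes Y: "Y \<subseteq> D" and fin: "finite (parabolic Y)"
  shows "descent_series {} = coset_series Y * fps_of_poly (parabolic_poly Y)"
proof (rule fps_ext)
  fix k
  define S where "S g = {u \<in> min_coset_reps Y. len u + len g = k}" for g
  have carr: "g \<in> carrier W" if "g \<in> parabolic Y" for g using parabolic_carrier[OF Y that] .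
  have finS: "finite (S g)" for g
  proof (rule finite_subset)
    show "S g \<subseteq> {w \<in> carrier W. len w = k - len g}" by (auto simp: S_def min_coset_reps_def)
  qed (rule finite_len_eq)
  have "{w \<in> carrier W. len w = k} = (\<Union>g\<in>parabolic Y. (\<lambda>u. u \<otimes> g) ` S g)"
  proof (intro equalityI subsetI)
    fix w assume w: "w \<in> {w \<in> carrier W. len w = k}"
    then obtain u v where "u \<in> min_coset_reps Y" "v \<in> parabolic Y" "w = u \<otimes> v"
      using coset_decomposition[OF Y] by blast
    then show "w \<in> (\<Union>g\<in>parabolic Y. (\<lambda>u. u \<otimes> g) ` S g)"
      using coset_inversions(2)[OF Y] w by (auto simp: S_def)
  next
    fix w assume "w \<in> (\<Union>g\<in>parabolic Y. (\<lambda>u. u \<otimes> g) ` S g)"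
    then obtain u g where "u \<in> min_coset_reps Y" "len u + len g = k" "g \<in> parabolic Y" "w = u \<otimes> g"
      by (auto simp: S_def)
    then show "w \<in> {w \<in> carrier W. len w = k}"
      using coset_inversions(2)[OF Y] min_coset_reps_carrier carr by auto
  qed
  then have "card {w \<in> carrier W. len w = k} = (\<Sum>g\<in>parabolic Y. card ((\<lambda>u. u \<otimes> g) ` S g))"
  proof (simp only:, intro card_UN_disjoint ballI impI fin)
    fix g h assume "g \<in> parabolic Y" "h \<in> parabolic Y" "g \<noteq> h"
    then show "(\<lambda>u. u \<otimes> g) ` S g \<inter> (\<lambda>u. u \<otimes> h) ` S h = {}"
      using coset_decomposition_unique[OF Y] by (fastforce simp: S_def)
  qed (simp add: finS)
  also have "\<dots> = (\<Sum>g\<in>parabolic Y. card (S g))"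
  proof (intro sum.cong refl card_image inj_onI)
    fix g x y assume "g \<in> parabolic Y" "x \<in> S g" "y \<in> S g" "x \<otimes> g = y \<otimes> g"
    then show "x = y" using coset_decomposition_unique[OF Y, of x y g g] by (simp add: S_def)
  qed
  finally have "card {w \<in> carrier W. len w = k} = (\<Sum>g\<in>parabolic Y. card (S g))" .
  then show "fps_nth (descent_series {}) k = fps_nth (coset_series Y * fps_of_poly (parabolic_poly Y)) k"
    by (simp add: descent_series_def parabolic_poly_def fps_of_poly_sum fps_of_poly_monom'
        sum_distrib_left fps_sum_nth coset_series_shift_nth S_def)
qed

text \<open>The complement of \<open>g\<close> in \<open>v\<close> has length 0.\<close>

lemma longest_element_unique:
  assumes Y: "Y \<subseteq> D" and "v \<in> parabolic Y" "Y \<subseteq> N v" "g \<in> parabolic Y" "len v \<le> len g"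
  shows "g = v"
proof -
  have c: "v \<in> carrier W" "g \<in> carrier W" using assms parabolic_carrier[OF Y] by auto
  have "len (v \<otimes> inv g) = 0" using len_complement[OF Y assms(2-4)] assms(5) by simp
  then have "v \<otimes> inv g = \<one>" using c by simp
  then show ?thesis using c inv_solve_right'[of \<one> v g] by simp
qed

text \<open>Whether \<open>Y\<close> consists of descents of \<open>u g\<close> depends only on the
  parabolic part \<open>g\<close>, which must then be the longest element \<open>v\<close>.\<close>

lemma descent_series_factor:
  assumes Y: "Y \<subseteq> D" and v: "v \<in> parabolic Y" "Y \<subseteq> N v"
  shows "descent_series Y = coset_series Y * fps_X ^ len v"
proof (rule fps_ext)
  fix k
  define S where "S = {u \<in> min_coset_reps Y. len u + len v = k}"
  have YP: "Y \<subseteq> parabolic Y" by (auto intro: generate.incl)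
  have vc: "v \<in> carrier W" using parabolic_carrier[OF Y v(1)] .
  have "{w \<in> carrier W. len w = k \<and> Y \<subseteq> N w} = (\<lambda>u. u \<otimes> v) ` S"
  proof (intro equalityI subsetI)
    fix w assume w: "w \<in> {w \<in> carrier W. len w = k \<and> Y \<subseteq> N w}"
    then obtain u g where ug: "u \<in> min_coset_reps Y" "g \<in> parabolic Y" "w = u \<otimes> g"
      using coset_decomposition[OF Y] by blast
    then have "Y \<subseteq> N g" using coset_inversions(1)[OF Y ug(1,2)] YP w by blast
    then have "len v \<le> len g" using len_complement[OF Y ug(2) _ v(1)] by simp
    then have "g = v" using longest_element_unique[OF Y v ug(2)] by blast
    then show "w \<in> (\<lambda>u. u \<otimes> v) ` S"
      using coset_inversions(2)[OF Y ug(1,2)] w ug by (auto simp: S_def)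
  next
    fix w assume "w \<in> (\<lambda>u. u \<otimes> v) ` S"
    then obtain u where u: "u \<in> min_coset_reps Y" "len u + len v = k" "w = u \<otimes> v"
      by (auto simp: S_def)
    then show "w \<in> {w \<in> carrier W. len w = k \<and> Y \<subseteq> N w}"
      using coset_inversions[OF Y u(1) v(1)] min_coset_reps_carrier[OF u(1)] vc v(2) by auto
  qed
  moreover have "inj_on (\<lambda>u. u \<otimes> v) S"
    using vc by (intro inj_onI) (auto simp: S_def min_coset_reps_def)
  ultimately have "card {w \<in> carrier W. len w = k \<and> Y \<subseteq> N w} = card S"
    by (simp add: card_image)
  then show "fps_nth (descent_series Y) k = fps_nth (coset_series Y * fps_X ^ len v) k"
    by (simp add: descent_series_def coset_series_shift_nth S_def)
qed

text \<open>After exchanging the sums, each \<open>w\<close> contributes the alternating sum over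
  subsets of its descent set, which is nonzero only for the identity.\<close>

lemma sum_descent_series:
  "(\<Sum>Y \<in> {Y. Y \<subseteq> D \<and> finite (parabolic Y)}. fps_const ((-1) ^ card Y) * descent_series Y) = 1"
proof (rule fps_ext)
  fix k
  define F where "F = {Y. Y \<subseteq> D \<and> finite (parabolic Y)}"
  define L where "L = {w \<in> carrier W. len w = k}"
  have fin: "finite F" "finite L"
    using finite_D by (simp_all add: F_def L_def finite_len_eq)
  have "(\<Sum>Y\<in>F. (-1) ^ card Y * real (card {w \<in> carrier W. len w = k \<and> Y \<subseteq> N w}))
     = (\<Sum>Y\<in>F. \<Sum>w\<in>{w\<in>L. Y \<subseteq> N w}. (-1 :: real) ^ card Y)"
    by (intro sum.cong refl) (simp add: L_def conj_assoc mult.commute)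
  also have "\<dots> = (\<Sum>w\<in>L. \<Sum>Y\<in>{Y\<in>F. Y \<subseteq> N w}. (-1 :: real) ^ card Y)"
    using fin by (rule sum.swap_restrict)
  also have "\<dots> = (\<Sum>w\<in>L. if w = \<one> then 1 else 0)"
  proof (intro sum.cong refl)
    fix w assume "w \<in> L"
    then have w: "w \<in> carrier W" by (simp add: L_def)
    \<comment> \<open>Every set of descents of \<open>w\<close> generates a finite subgroup, so
      restricting to \<open>F\<close> loses no subset.\<close>
    have "{Y\<in>F. Y \<subseteq> N w} = Pow (D \<inter> N w)"
      using finite_parabolic_if_descents[OF _ w] by (auto simp: F_def)
    moreover have "(\<Sum>Y\<in>Pow (D \<inter> N w). (-1 :: real) ^ card Y) = (if w = \<one> then 1 else 0)"
    proof (cases "w = \<one>")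
      case False
      then show ?thesis using sum_alternating_Pow[of "D \<inter> N w"] descents_empty_iff[OF w] finite_D by simp
    qed simp
    ultimately show "(\<Sum>Y\<in>{Y\<in>F. Y \<subseteq> N w}. (-1 :: real) ^ card Y) = (if w = \<one> then 1 else 0)" by simp
  qed
  also have "\<dots> = (if k = 0 then 1 else 0)"
    using fin(2) by (auto simp: L_def)
  finally show "fps_nth (\<Sum>Y \<in> {Y. Y \<subseteq> D \<and> finite (parabolic Y)}. fps_const ((-1) ^ card Y) * descent_series Y) k
      = fps_nth 1 k"
    by (simp add: fps_sum_nth descent_series_def F_def)
qed

text \<open>Only \<open>v\<close> has top length. An element one shorter has a complement of length
  1, that is a generator \<open>x\<close> in \<open>Y\<close>, and hence equals
  \<open>x v\<close>.\<close>

lemma top_coeffs_parabolic_poly: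
  assumes Y: "Y \<subseteq> D" and fin: "finite (parabolic Y)" and v: "v \<in> parabolic Y" "Y \<subseteq> N v"
  shows "top_coeffs (len v) (parabolic_poly Y) 1 (real (card Y))"
proof -
  interpret P: subgroup "parabolic Y" W by (rule parabolic_subgroup[OF Y])
  have vc: "v \<in> carrier W" using parabolic_carrier[OF Y v(1)] .
  have coeff: "coeff (parabolic_poly Y) k = real (card {g \<in> parabolic Y. len g = k})" for k
    using fin by (simp add: parabolic_poly_def coeff_sum sum.If_cases Int_def)
  have le: "len g \<le> len v" if "g \<in> parabolic Y" for g
    using len_complement[OF Y v that] by simp
  have top: "{g \<in> parabolic Y. len g = len v} = {v}"
  proof (intro equalityI subsetI)
    fix g assume "g \<in> {g \<in> parabolic Y. len g = len v}"
    then show "g \<in> {v}" using longest_element_unique[OF Y v, of g] by simp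
  qed (simp add: v(1))
  \<comment> \<open>Writing \<open>Suc (len g) = len v\<close> avoids truncated subtraction: the set
    is empty if \<open>len v = 0\<close>.\<close>
  have sub: "{g \<in> parabolic Y. Suc (len g) = len v} = (\<lambda>x. x \<otimes> v) ` Y"
  proof (intro equalityI subsetI)
    fix g assume g: "g \<in> {g \<in> parabolic Y. Suc (len g) = len v}"
    then have gc: "g \<in> carrier W" using parabolic_carrier[OF Y] by simp
    define x where "x = v \<otimes> inv g"
    have x: "x \<in> parabolic Y" using g v by (simp add: x_def)
    have "len x = 1" using len_complement[OF Y v, of g] g by (simp add: x_def)
    then have xY: "x \<in> Y" using len_eq_1_iff[OF Y x] by simp
    then have xx: "x \<otimes> x = \<one>" "x \<in> carrier W" using Y D_carrier D_square by auto
    have "x \<otimes> g = v" using gc vc by (simp add: x_def m_assoc)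
    then have "g = x \<otimes> v" using xx gc by (metis l_one m_assoc)
    with xY show "g \<in> (\<lambda>x. x \<otimes> v) ` Y" by blast
  next
    fix g assume "g \<in> (\<lambda>x. x \<otimes> v) ` Y"
    then obtain x where x: "x \<in> Y" "g = x \<otimes> v" by blast
    have xD: "x \<in> D" "x \<in> carrier W" using x Y D_carrier by auto
    have g: "g \<in> parabolic Y" using x v(1) by (simp add: generate.incl)
    have "v \<otimes> inv g = x"
      using vc xD x(2) inv_gen[OF xD(1)] by (simp add: inv_mult_group)
    then have "len v = Suc (len g)"
      using len_complement[OF Y v g] N_gen[OF xD(1)] by simp
    with g show "g \<in> {g \<in> parabolic Y. Suc (len g) = len v}" by simp
  qed
  have "inj_on (\<lambda>x. x \<otimes> v) Y" using vc Y D_carrier by (intro inj_onI) (metis right_cancel subsetD)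
  then have card: "card {g \<in> parabolic Y. Suc (len g) = len v} = card Y"
    unfolding sub by (rule card_image)
  show ?thesis unfolding top_coeffs_def
  proof (intro conjI allI impI)
    fix i assume "i > len v"
    then have "{g \<in> parabolic Y. len g = i} = {}" using le by fastforce
    then show "coeff (parabolic_poly Y) i = 0" by (simp only: coeff card.empty of_nat_0)
  next
    show "coeff (parabolic_poly Y) (len v) = 1" unfolding coeff top by simp
  next
    show "coeff (pCons 0 (parabolic_poly Y)) (len v) = real (card Y)"
      using card by (cases "len v") (simp_all add: coeff)
  qed
qed

text \<open>Clearing denominators in the formula for 1/W(t) gives \<open>P = W(t) Q\<close>, hence
  the polynomial identity \<open>P q = p Q\<close>, whose two highest coefficients are
  compared.\<close>

lemma length_series_top_coeffs:
  fixes p q :: "real poly"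
  assumes eq: "descent_series {} * fps_of_poly q = fps_of_poly p" and p: "top_coeffs e p 1 c"
  defines "F \<equiv> {Y. Y \<subseteq> D \<and> finite (parabolic Y)}"
  shows "coeff (pCons 0 q) e - c * coeff q e = - (\<Sum>Y\<in>F. (-1) ^ card Y * real (card Y))"
proof -
  have "finite F" using finite_D by (simp add: F_def)
  have "\<exists>v\<in>parabolic Y. Y \<subseteq> N v" if "Y \<in> F" for Y
    using that longest_element_exists[of Y] by (metis (no_types, lifting) F_def mem_Collect_eq)
  then obtain v where v: "\<And>Y. Y \<in> F \<Longrightarrow> v Y \<in> parabolic Y" "\<And>Y. Y \<in> F \<Longrightarrow> Y \<subseteq> N (v Y)"
    by metis
  define l where "l Y = len (v Y)" for Y
  define s where "s = (\<Sum>Y\<in>F. real (card Y))"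
  define P where "P = (\<Prod>Y\<in>F. parabolic_poly Y)"
  \<comment> \<open>The numerator over the common denominator \<open>P\<close>; every summand is
    recorded with the same degree bound as \<open>P\<close>, as \<open>t^(l Y)\<close> replaces a
    factor of degree \<open>l Y\<close>.\<close>
  define Q where "Q = (\<Sum>Y\<in>F. monom ((-1) ^ card Y) (l Y) * (\<Prod>Z\<in>F - {Y}. parabolic_poly Z))"
  have top: "top_coeffs (l Y) (parabolic_poly Y) 1 (real (card Y))" if "Y \<in> F" for Y
    using top_coeffs_parabolic_poly[of Y "v Y"] v[OF that] that by (simp add: F_def l_def)
  have P: "top_coeffs (\<Sum>Y\<in>F. l Y) P 1 s"
    unfolding P_def s_def using \<open>finite F\<close> top by (intro top_coeffs_prod) auto
  have Q: "top_coeffs (\<Sum>Y\<in>F. l Y) Q (\<Sum>Y\<in>F. (-1) ^ card Y) (\<Sum>Y\<in>F. (-1) ^ card Y * (s - real (card Y)))"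
    unfolding Q_def
  proof (rule top_coeffs_sum)
    fix Y assume Y: "Y \<in> F"
    have "top_coeffs (\<Sum>Z\<in>F - {Y}. l Z) (\<Prod>Z\<in>F - {Y}. parabolic_poly Z) 1 (\<Sum>Z\<in>F - {Y}. real (card Z))"
      using \<open>finite F\<close> top by (intro top_coeffs_prod) auto
    from top_coeffs_mult[OF top_coeffs_monom[of "l Y" "(-1) ^ card Y"] this]
    show "top_coeffs (\<Sum>Y\<in>F. l Y) (monom ((-1) ^ card Y) (l Y) * (\<Prod>Z\<in>F - {Y}. parabolic_poly Z))
      ((-1) ^ card Y) ((-1) ^ card Y * (s - real (card Y)))"
      using \<open>finite F\<close> Y by (simp add: s_def sum.remove)
  qed
  have "fps_of_poly P = (\<Sum>Y\<in>F. fps_const ((-1) ^ card Y) * descent_series Y) * fps_of_poly P"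
    using sum_descent_series by (simp add: F_def)
  also have "\<dots> = (\<Sum>Y\<in>F. descent_series {} *
      fps_of_poly (monom ((-1) ^ card Y) (l Y) * (\<Prod>Z\<in>F - {Y}. parabolic_poly Z)))"
    unfolding sum_distrib_right
  proof (intro sum.cong refl)
    fix Y assume Y: "Y \<in> F"
    then have YD: "Y \<subseteq> D" "finite (parabolic Y)" by (auto simp: F_def)
    have "P = parabolic_poly Y * (\<Prod>Z\<in>F - {Y}. parabolic_poly Z)"
      unfolding P_def using \<open>finite F\<close> Y by (rule prod.remove)
    then show "fps_const ((-1) ^ card Y) * descent_series Y * fps_of_poly P = descent_series {} *
      fps_of_poly (monom ((-1) ^ card Y) (l Y) * (\<Prod>Z\<in>F - {Y}. parabolic_poly Z))"
      unfolding descent_series_factor[OF YD(1) v(1)[OF Y] v(2)[OF Y]] length_series_factor[OF YD]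
      by (simp add: fps_of_poly_mult fps_of_poly_monom l_def mult_ac)
  qed
  also have "\<dots> = descent_series {} * fps_of_poly Q"
    by (simp add: Q_def fps_of_poly_sum sum_distrib_left)
  finally have "fps_of_poly (P * q) = fps_of_poly (p * Q)"
    using eq by (simp add: fps_of_poly_mult mult_ac)
  then have "P * q = p * Q" by (simp only: fps_of_poly_eq_iff)
  moreover have "top_coeffs (e + (\<Sum>Y\<in>F. l Y)) (p * Q) (1 * (\<Sum>Y\<in>F. (-1) ^ card Y))
     (1 * (\<Sum>Y\<in>F. (-1) ^ card Y * (s - real (card Y))) + c * (\<Sum>Y\<in>F. (-1) ^ card Y))"
    by (rule top_coeffs_mult[OF p Q])
  ultimately have "top_coeffs e q (\<Sum>Y\<in>F. (-1) ^ card Y)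
      ((\<Sum>Y\<in>F. (-1) ^ card Y * (s - real (card Y))) + c * (\<Sum>Y\<in>F. (-1) ^ card Y)
        - s * (\<Sum>Y\<in>F. (-1) ^ card Y))"
    using top_coeffs_mult_cancel[OF P, of e q] by (simp add: add.commute)
  \<comment> \<open>The multiples of \<open>s\<close> cancel, and subtracting \<open>c\<close> times
    the leading coefficient removes the remaining term in \<open>c\<close>.\<close>
  then show ?thesis
    by (simp add: top_coeffs_def sum_subtractf algebra_simps sum_distrib_left)
qed

end

section \<open>From finite parabolic subgroups to the infinite ones\<close>

theorem mainTheorem10:
  fixes W :: "'w monoid" and D :: "'w set"
    and m :: nat and n :: "nat \<Rightarrow> nat" and Sp :: "real poly"
  assumes "coxeter_system W D"
    and "finite D"
    and "infinite (carrier W)"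
    and "\<forall>i<m. n i \<ge> 2"
    and "poincare_series W D * fps_of_poly Sp = fps_of_poly (\<Prod>i<m. qint (n i))"
  shows "(let N = (\<Sum>i<m. n i - 1);
              b = (\<lambda>j::int. if j < 0 then 0 else coeff Sp (nat j))
          in b (int N - 1) - real m * b (int N))
         = (\<Sum>X \<in> {X. X \<subset> D \<and> infinite (generate W X)}.
               (-1) ^ card X * real (card X))
           + (-1) ^ card D * real (card D)"
proof -
  have cox: "group W" "D \<subseteq> carrier W" "generate W D = carrier W"
    "\<And>s. s \<in> D \<Longrightarrow> s \<otimes>\<^bsub>W\<^esub> s = \<one>\<^bsub>W\<^esub>"
    using assms(1) by (auto simp: coxeter_system_def)
  obtain N where N: "\<forall>s\<in>D. N s = {s}"
    "\<forall>u\<in>carrier W. \<forall>v\<in>carrier W. N (u \<otimes>\<^bsub>W\<^esub> v) =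
       {x \<in> carrier W. (x \<in> N v) \<noteq> (v \<otimes>\<^bsub>W\<^esub> x \<otimes>\<^bsub>W\<^esub> inv\<^bsub>W\<^esub> v \<in> N u)}"
    using coxeter_system_inversion_cocycle[OF assms(1,2)] by blast
  interpret group W by (fact cox(1))
  interpret finite_coxeter_cocycle W D N
  proof
    show "D \<subseteq> carrier W" "finite D" "generate W D = carrier W"
      by (fact cox(2) assms(2) cox(3))+
    show "s \<otimes>\<^bsub>W\<^esub> s = \<one>\<^bsub>W\<^esub>" "N s = {s}" if "s \<in> D" for s
      using that cox(4) N(1) by blast+
  qed (rule N(2)[rule_format])
  define e where "e = (\<Sum>i<m. n i - 1)"
  define F where "F = {Y. Y \<subseteq> D \<and> finite (generate W Y)}"
  define f :: "'w set \<Rightarrow> real" where "f X = (-1) ^ card X * real (card X)" for X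
  have "top_coeffs e (\<Prod>i<m. qint (n i)) 1 (\<Sum>i<m. 1)"
    unfolding e_def using assms(4) by (intro top_coeffs_prod top_coeffs_qint) auto
  then have main: "coeff (pCons 0 Sp) e - real m * coeff Sp e = - (\<Sum>Y\<in>F. f Y)"
    using length_series_top_coeffs[of Sp "\<Prod>i<m. qint (n i)" e "real m"] assms(5)
    by (simp add: poincare_series_eq F_def f_def)
  have finite_proper: "finite {X. X \<subset> D \<and> infinite (generate W X)}"
    by (rule finite_subset[of _ "Pow D"]) (use assms(2) in auto)
  \<comment> \<open>A single involution generates at most two elements, contradicting that
    \<open>W\<close> is infinite.\<close>
  have "card D \<noteq> 1"
  proof
    assume "card D = 1"
    then obtain s where s: "D = {s}" by (rule card_1_singletonE)
    have sc: "s \<in> carrier W" "s \<otimes>\<^bsub>W\<^esub> s = \<one>\<^bsub>W\<^esub>" using cox s by auto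
    have "subgroup {\<one>\<^bsub>W\<^esub>, s} W"
      using sc inv_gen[of s] s by (intro subgroupI) auto
    then have "generate W D \<subseteq> {\<one>\<^bsub>W\<^esub>, s}"
      using s by (intro generate_subgroup_incl) auto
    then show False using cox(3) assms(3) by (metis finite.emptyI finite.insertI finite_subset)
  qed
  then have "(\<Sum>X\<in>Pow D. f X) = 0"
    unfolding f_def using assms(2) by (intro sum_alternating_card_Pow)
  \<comment> \<open>As \<open>D\<close> itself generates an infinite group, it is split off from the
    proper subsets; this gives the last term of the formula.\<close>
  moreover have "Pow D = F \<union> insert D {X. X \<subset> D \<and> infinite (generate W X)}"
    by (auto simp: F_def)
  moreover have "(\<Sum>X\<in>F \<union> insert D {X. X \<subset> D \<and> infinite (generate W X)}. f X)
     = (\<Sum>X\<in>F. f X) + (\<Sum>X\<in>insert D {X. X \<subset> D \<and> infinite (generate W X)}. f X)"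
  proof (rule sum.union_disjoint)
    show "finite F" using assms(2) by (simp add: F_def)
    show "finite (insert D {X. X \<subset> D \<and> infinite (generate W X)})"
      using finite_proper by simp
    show "F \<inter> insert D {X. X \<subset> D \<and> infinite (generate W X)} = {}"
      using cox(3) assms(3) by (auto simp: F_def)
  qed
  moreover have "(\<Sum>X\<in>insert D {X. X \<subset> D \<and> infinite (generate W X)}. f X)
     = f D + (\<Sum>X\<in>{X. X \<subset> D \<and> infinite (generate W X)}. f X)"
    using finite_proper by simp
  ultimately have "- (\<Sum>Y\<in>F. f Y) = (\<Sum>X\<in>{X. X \<subset> D \<and> infinite (generate W X)}. f X) + f D"
    by simp
  \<comment> \<open>For \<open>e = 0\<close> both sides are 0, matching the convention that
    coefficients at negative indices vanish.\<close>
  moreover have "coeff (pCons 0 Sp) e = (if int e - 1 < 0 then 0 else coeff Sp (nat (int e - 1)))"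
    by (cases e) simp_all
  ultimately have "(if int e - 1 < 0 then 0 else coeff Sp (nat (int e - 1)))
      - real m * (if int e < 0 then 0 else coeff Sp (nat (int e)))
    = (\<Sum>X\<in>{X. X \<subset> D \<and> infinite (generate W X)}. f X) + f D"
    using main by simp
  then show ?thesis unfolding Let_def e_def f_def .
qed

end
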